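(* Let $k,a$ be positive integers and let $(G_{k,n})_{n\ge 0}$ be the Generalized $k$-Pell sequence with $G_{k,0}=G_{k,1}=a$. If $m,n$ are nonnegative integers with $m>n$, then \[G_{k,m}G_{k,n+1}-G_{k,m+1}G_{k,n}=a(-1)^n k^n\sqrt{1+k}\left(G_{k,m-n}-a\left(1+\sqrt{1+k}\right)^{m-n}\right).\]
   Context: For positive integers $k,a$, the Generalized $k$-Pell sequence $(G_{k,n})_{n\ge 0}$ is the integer sequence defined by $G_{k,0}=G_{k,1}=a$ and $G_{k,n}=2G_{k,n-1}+kG_{k,n-2}$ for $n\ge 2$. *)

theory Defs
  imports Complex_Main
begin

fun gen_pell :: "int \<Rightarrow> int \<Rightarrow> nat \<Rightarrow> int" where
  "gen_pell k a 0 = a"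
| "gen_pell k a (Suc 0) = a"
| "gen_pell k a (Suc (Suc n)) = 2 * gen_pell k a (Suc n) + k * gen_pell k a n"

end

theory Submission
  imports Defs
begin

text \<open>
  The characteristic polynomial \<open>x\<^sup>2 - 2x - k\<close> of the recurrence has the roots
  \<open>\<alpha> = 1 + s\<close> and \<open>\<beta> = 1 - s\<close> with \<open>s = sqrt (1 + k)\<close>. The two initial values are equal, so
  both roots get the same coefficient in the Binet formula, \<open>G\<^sub>n = a/2 (\<alpha>\<^sup>n + \<beta>\<^sup>n)\<close>. With
  \<open>d = m - n\<close>, the pure powers \<open>\<alpha>\<^sup>m\<^sup>+\<^sup>n\<^sup>+\<^sup>1\<close> and \<open>\<beta>\<^sup>m\<^sup>+\<^sup>n\<^sup>+\<^sup>1\<close> cancel in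
  \<open>G\<^sub>m G\<^sub>n\<^sub>+\<^sub>1 - G\<^sub>m\<^sub>+\<^sub>1 G\<^sub>n\<close>, and every mixed term contains the factor \<open>(\<alpha>\<beta>)\<^sup>n = (-k)\<^sup>n\<close>. What
  remains is \<open>a\<^sup>2/2 (-k)\<^sup>n s (\<beta>\<^sup>d - \<alpha>\<^sup>d)\<close>, where \<open>a/2 (\<beta>\<^sup>d - \<alpha>\<^sup>d) = G\<^sub>d - a \<alpha>\<^sup>d\<close>.
\<close>

text \<open>
  Both sides satisfy the same second-order recurrence, because \<open>1 + s\<close> and \<open>1 - s\<close> are roots
  of its characteristic polynomial, and they agree at \<open>0\<close> and \<open>1\<close>. The bound on \<open>k\<close> makes
  \<open>sqrt (1 + k)\<close> a true square root.
\<close>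
lemma gen_pell_binet:
  fixes k a :: int
  assumes "k \<ge> -1"
  defines "s \<equiv> sqrt (1 + real_of_int k)"
  shows "real_of_int (gen_pell k a n) = real_of_int a / 2 * ((1 + s) ^ n + (1 - s) ^ n)"
proof (induction n rule: induct_nat_012)
  case (ge2 n)
  have k: "real_of_int k = s\<^sup>2 - 1"
    using assms by simp
  show ?case
    by (simp add: ge2 k power2_eq_square) (simp add: field_simps)
qed simp_all

theorem theorem2p6:
  fixes k a :: int and m n :: nat
  assumes "k > 0" and "a > 0" and "m > n"
  shows "real_of_int (gen_pell k a m * gen_pell k a (n + 1) - gen_pell k a (m + 1) * gen_pell k a n)
    = real_of_int a * (- 1) ^ n * real_of_int k ^ n * sqrt (1 + real_of_int k)
      * (real_of_int (gen_pell k a (m - n)) - real_of_int a * (1 + sqrt (1 + real_of_int k)) ^ (m - n))"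
proof -
  define s where "s = sqrt (1 + real_of_int k)"
  define A where "A = real_of_int a"
  define d where "d = m - n"
  have m: "m = n + d"
    using assms(3) by (simp add: d_def)
  have binet: "real_of_int (gen_pell k a j) = A / 2 * ((1 + s) ^ j + (1 - s) ^ j)" for j
    using gen_pell_binet[of k a j] assms(1) by (simp add: s_def A_def)
  have "(1 + s) * (1 - s) = - real_of_int k"
    using assms(1) by (simp add: s_def algebra_simps)
  then have roots: "(1 + s) ^ n * (1 - s) ^ n = (- 1) ^ n * real_of_int k ^ n"
    by (metis power_mult_distrib mult_minus1)
  have "real_of_int (gen_pell k a m * gen_pell k a (n + 1) - gen_pell k a (m + 1) * gen_pell k a n)
      = A * ((1 + s) ^ n * (1 - s) ^ n) * s * (A / 2 * ((1 - s) ^ d - (1 + s) ^ d))"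
  proof -
    \<comment> \<open>Opaque names for the powers make the identity polynomial, with \<open>1 + s\<close> and \<open>1 - s\<close>
      hidden under the symbolic exponents.\<close>
    define p q u v where "p = (1 + s) ^ n" and "q = (1 - s) ^ n"
      and "u = (1 + s) ^ d" and "v = (1 - s) ^ d"
    show ?thesis
      unfolding of_int_diff of_int_mult binet m power_add power_one_right
        p_def[symmetric] q_def[symmetric] u_def[symmetric] v_def[symmetric]
      by (simp add: field_simps)
  qed
  also have "A / 2 * ((1 - s) ^ d - (1 + s) ^ d)
      = real_of_int (gen_pell k a d) - A * (1 + s) ^ d"
    by (simp add: binet field_simps)
  finally show ?thesis
    unfolding roots by (simp add: s_def A_def d_def mult.assoc)
qed

end
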